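(* Let $H\subset\mathbb{R}$ and let $K:H^2\to H$ be a strict, continuous, monotone right-mean such that either $K$ is semi-reflexive or $H$ is bounded from below. For $a,b,c\in H$ with $a\le b\le c$ set $a_0=a$, $b_0=b$, $c_0=c$ and, for $n\ge 0$, $$a_{n+1}=K(a_n,b_n),\qquad b_{n+1}=K(a_n,c_n),\qquad c_{n+1}=K(b_n,c_n).$$ Let $\tilde K$ be the real-valued function on $T=\{(a,b,c)\in H^3: a\le b\le c\}$ such that, for every $(a,b,c)\in T$, $\tilde K(a,b,c)$ is the common limit of the three sequences $(a_n),(b_n),(c_n)$. Then $\tilde K$ is a strict, upper semi-continuous, monotone right-mean.
   Context: A function $K:H^2\to\mathbb{R}$ is a right-mean if $K(x,y)\le\max\{x,y\}$ for all $x,y\in H$; it is strict if $K(x,y)<\max\{x,y\}$ whenever $x\neq y$; it is monotone if $x\le x'$, $y\le y'$ implies $K(x,y)\le K(x',y')$; it is semi-reflexive if $b=K(a,a)$ implies $K(b,b)=b$. For the function $\tilde K$ on $T$: right-mean means $\tilde K(a,b,c)\le\max\{a,b,c\}$; strict means $\tilde K(a,b,c)<\max\{a,b,c\}$ whenever $a,b,c$ are not all equal; monotone means $\tilde K(a',b',c')\le\tilde K(a,b,c)$ whenever $(a',b',c'),(a,b,c)\in T$ with $a'\le a$, $b'\le b$, $c'\le c$. The existence of the common limit is part of the definition of $\tilde K$. *)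

theory Defs
  imports "HOL-Analysis.Analysis"
begin

definition right_mean2 :: "real set \<Rightarrow> (real \<times> real \<Rightarrow> real) \<Rightarrow> bool" where
  "right_mean2 H K \<longleftrightarrow> (\<forall>x\<in>H. \<forall>y\<in>H. K (x, y) \<le> max x y)"

definition strict2 :: "real set \<Rightarrow> (real \<times> real \<Rightarrow> real) \<Rightarrow> bool" where
  "strict2 H K \<longleftrightarrow> (\<forall>x\<in>H. \<forall>y\<in>H. x \<noteq> y \<longrightarrow> K (x, y) < max x y)"

definition monotone2 :: "real set \<Rightarrow> (real \<times> real \<Rightarrow> real) \<Rightarrow> bool" where
  "monotone2 H K \<longleftrightarrow>
     (\<forall>x\<in>H. \<forall>y\<in>H. \<forall>x'\<in>H. \<forall>y'\<in>H. x \<le> x' \<longrightarrow> y \<le> y' \<longrightarrow> K (x, y) \<le> K (x', y'))"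

text \<open>
  The condition \<open>b = K(a,a) \<Longrightarrow> K(b,b) = b\<close> makes sense only for \<open>b \<in> H\<close>; below it is
  used for functions mapping \<open>H \<times> H\<close> into \<open>H\<close>, where this is automatic.
\<close>
definition semi_reflexive :: "real set \<Rightarrow> (real \<times> real \<Rightarrow> real) \<Rightarrow> bool" where
  "semi_reflexive H K \<longleftrightarrow> (\<forall>a\<in>H. \<forall>b\<in>H. b = K (a, a) \<longrightarrow> K (b, b) = b)"

definition ordered_triples :: "real set \<Rightarrow> (real \<times> real \<times> real) set" where
  "ordered_triples H = {(a, b, c). a \<in> H \<and> b \<in> H \<and> c \<in> H \<and> a \<le> b \<and> b \<le> c}"

primrec mean_iter ::
    "(real \<times> real \<Rightarrow> real) \<Rightarrow> real \<times> real \<times> real \<Rightarrow> nat \<Rightarrow> real \<times> real \<times> real" where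
  "mean_iter K t 0 = t"
| "mean_iter K t (Suc n) =
     (case mean_iter K t n of (a, b, c) \<Rightarrow> (K (a, b), K (a, c), K (b, c)))"

text \<open>Existence of the common limit at every point of \<open>T\<close> is part of this condition.\<close>
definition is_limit_mean ::
    "real set \<Rightarrow> (real \<times> real \<Rightarrow> real) \<Rightarrow> (real \<times> real \<times> real \<Rightarrow> real) \<Rightarrow> bool" where
  "is_limit_mean H K Kt \<longleftrightarrow> (\<forall>t\<in>ordered_triples H.
     (\<lambda>n. fst (mean_iter K t n)) \<longlonglongrightarrow> Kt t \<and>
     (\<lambda>n. fst (snd (mean_iter K t n))) \<longlonglongrightarrow> Kt t \<and>
     (\<lambda>n. snd (snd (mean_iter K t n))) \<longlonglongrightarrow> Kt t)"

definition right_mean3 ::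
    "(real \<times> real \<times> real) set \<Rightarrow> (real \<times> real \<times> real \<Rightarrow> real) \<Rightarrow> bool" where
  "right_mean3 T F \<longleftrightarrow> (\<forall>(a, b, c)\<in>T. F (a, b, c) \<le> Max {a, b, c})"

definition strict3 ::
    "(real \<times> real \<times> real) set \<Rightarrow> (real \<times> real \<times> real \<Rightarrow> real) \<Rightarrow> bool" where
  "strict3 T F \<longleftrightarrow> (\<forall>(a, b, c)\<in>T. \<not> (a = b \<and> b = c) \<longrightarrow> F (a, b, c) < Max {a, b, c})"

definition monotone3 ::
    "(real \<times> real \<times> real) set \<Rightarrow> (real \<times> real \<times> real \<Rightarrow> real) \<Rightarrow> bool" where
  "monotone3 T F \<longleftrightarrow> (\<forall>(a', b', c')\<in>T. \<forall>(a, b, c)\<in>T.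
     a' \<le> a \<longrightarrow> b' \<le> b \<longrightarrow> c' \<le> c \<longrightarrow> F (a', b', c') \<le> F (a, b, c))"

text \<open>Upper semi-continuity with respect to the subspace topology on \<open>S\<close>.\<close>
definition usc_on :: "'a::topological_space set \<Rightarrow> ('a \<Rightarrow> real) \<Rightarrow> bool" where
  "usc_on S f \<longleftrightarrow> (\<forall>x\<in>S. \<forall>y. f x < y \<longrightarrow> (\<forall>\<^sub>F z in at x within S. f z < y))"

end

theory Submission
  imports Defs "HOL-Library.Product_Order"
begin

text \<open>
  Write \<open>(a\<^sub>n, b\<^sub>n, c\<^sub>n)\<close> for the iterates of an ordered triple. They stay ordered, by monotonicity,
  and then \<open>c\<^sub>n\<^sub>+\<^sub>1 = K(b\<^sub>n, c\<^sub>n) \<le> c\<^sub>n\<close>, since \<open>K\<close> is a right-mean. So the limit mean is the infimum of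
  the decreasing sequence \<open>(c\<^sub>n)\<close>, and in particular it is at most \<open>c\<^sub>n\<close> for every \<open>n\<close>
  (\<open>limit_mean_le_largest\<close>). Everything except monotonicity is read off from this.

  For \<open>n = 0\<close> the bound is the right-mean property. Each \<open>c\<^sub>n\<close> is a continuous function of the
  starting triple (\<open>continuous_on_mean_iter\<close>), and an infimum of continuous functions is upper
  semi-continuous; lower semi-continuity cannot be obtained this way, because
  \<open>(a\<^sub>n)\<close> need not be increasing. For strictness it suffices that \<open>c\<^sub>n < c\<^sub>0\<close> for some \<open>n\<close>.
  If the two largest entries differ, then \<open>n = 1\<close> will do. If they agree, then the smallest one
  differs from them, so that the first step makes \<open>b\<^sub>1 < c\<^sub>0\<close>, and \<open>n = 2\<close> will do
  (\<open>largest_iterate_strict\<close>). Finally, every iterate is monotone in the starting triple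
  (\<open>mean_iter_mono\<close>), and limits preserve weak inequalities.
\<close>

lemma ordered_triples_iff [simp]:
  "(a, b, c) \<in> ordered_triples H \<longleftrightarrow> a \<in> H \<and> b \<in> H \<and> c \<in> H \<and> a \<le> b \<and> b \<le> c"
  by (simp add: ordered_triples_def)

lemma monotone2D:
  assumes "monotone2 H K" "x \<in> H" "y \<in> H" "x' \<in> H" "y' \<in> H" "x \<le> x'" "y \<le> y'"
  shows "K (x, y) \<le> K (x', y')"
  using assms unfolding monotone2_def by blast

lemma mean_iter_ordered:
  assumes K: "K \<in> H \<times> H \<rightarrow> H" and mono: "monotone2 H K" and t: "t \<in> ordered_triples H"
  shows "mean_iter K t n \<in> ordered_triples H"
proof (induction n)
  case 0
  show ?case using t by simp
next
  case (Suc n)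
  obtain a b c where it: "mean_iter K t n = (a, b, c)" by (rule prod_cases3)
  have abc: "a \<in> H" "b \<in> H" "c \<in> H" "a \<le> b" "b \<le> c"
    using Suc.IH it by auto
  have "K (a, b) \<in> H" "K (a, c) \<in> H" "K (b, c) \<in> H"
    using K abc by auto
  moreover have "K (a, b) \<le> K (a, c)" "K (a, c) \<le> K (b, c)"
    using abc by (auto intro!: monotone2D[OF mono])
  ultimately show ?case by (simp add: it)
qed

lemma decseq_largest_iterate:
  assumes K: "K \<in> H \<times> H \<rightarrow> H" and rm: "right_mean2 H K" and mono: "monotone2 H K"
    and t: "t \<in> ordered_triples H"
  shows "decseq (\<lambda>n. snd (snd (mean_iter K t n)))"
proof (rule decseq_SucI)
  fix n
  obtain a b c where it: "mean_iter K t n = (a, b, c)" by (rule prod_cases3)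
  have "b \<in> H" "c \<in> H" "b \<le> c"
    using mean_iter_ordered[OF K mono t, of n] it by auto
  then have "K (b, c) \<le> c"
    using rm unfolding right_mean2_def by (metis max.absorb2)
  then show "snd (snd (mean_iter K t (Suc n))) \<le> snd (snd (mean_iter K t n))"
    by (simp add: it)
qed

lemma limit_mean_le_largest:
  assumes "K \<in> H \<times> H \<rightarrow> H" "right_mean2 H K" "monotone2 H K" "is_limit_mean H K Kt"
    and "t \<in> ordered_triples H"
  shows "Kt t \<le> snd (snd (mean_iter K t n))"
proof (rule decseq_ge)
  show "decseq (\<lambda>n. snd (snd (mean_iter K t n)))"
    using assms(1-3,5) by (rule decseq_largest_iterate)
  show "(\<lambda>n. snd (snd (mean_iter K t n))) \<longlonglongrightarrow> Kt t"
    using assms(4,5) unfolding is_limit_mean_def by simp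
qed

text \<open>
  Two steps are needed in general: from \<open>a < b = c\<close> with \<open>K(c, c) = c\<close>, the first step leaves the
  largest entry where it was and only separates the other two entries from it.
\<close>
lemma largest_iterate_strict:
  assumes K: "K \<in> H \<times> H \<rightarrow> H" and rm: "right_mean2 H K" and st: "strict2 H K"
    and abc: "a \<in> H" "b \<in> H" "c \<in> H" "a \<le> b" "b \<le> c" and ne: "\<not> (a = b \<and> b = c)"
  shows "\<exists>n. snd (snd (mean_iter K (a, b, c) n)) < c"
proof -
  have strict: "K (x, y) < y" if "x \<in> H" "y \<in> H" "x < y" for x y
    using st that unfolding strict2_def by (metis less_irrefl max.absorb2 less_imp_le)
  show ?thesis
  proof (cases "K (b, c) < c")
    case True
    then show ?thesis by (intro exI[of _ 1]) simp
  next
    case False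
    then have "b = c" using strict abc by force
    then have "a < c" using abc ne by simp
    have "K (b, c) = c"
      using False rm \<open>b = c\<close> abc unfolding right_mean2_def by force
    moreover have "K (K (a, c), c) < c"
    proof (rule strict)
      show "K (a, c) \<in> H" using K abc by auto
      show "K (a, c) < c" using strict abc \<open>a < c\<close> by blast
    qed (use abc in simp)
    ultimately show ?thesis
      using \<open>b = c\<close> by (intro exI[of _ 2]) (simp add: numeral_2_eq_2)
  qed
qed

lemma continuous_on_mean_iter:
  assumes K: "K \<in> H \<times> H \<rightarrow> H" and mono: "monotone2 H K" and cont: "continuous_on (H \<times> H) K"
  shows "continuous_on (ordered_triples H) (\<lambda>t. mean_iter K t n)"
proof (induction n)
  case 0
  show ?case by simp
next
  case (Suc n)
  let ?a = "\<lambda>t. fst (mean_iter K t n)"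
  let ?b = "\<lambda>t. fst (snd (mean_iter K t n))"
  let ?c = "\<lambda>t. snd (snd (mean_iter K t n))"
  have in_H: "?a t \<in> H \<and> ?b t \<in> H \<and> ?c t \<in> H" if "t \<in> ordered_triples H" for t
    using mean_iter_ordered[OF K mono that, of n] by (cases "mean_iter K t n") simp
  have step: "continuous_on (ordered_triples H) (\<lambda>t. K (f t, g t))"
    if "continuous_on (ordered_triples H) f" "continuous_on (ordered_triples H) g"
      and "\<And>t. t \<in> ordered_triples H \<Longrightarrow> f t \<in> H \<and> g t \<in> H" for f g
    using that by (intro continuous_on_compose2[OF cont] continuous_on_Pair) auto
  have "continuous_on (ordered_triples H) (\<lambda>t. (K (?a t, ?b t), K (?a t, ?c t), K (?b t, ?c t)))"
    using Suc.IH in_H by (intro continuous_on_Pair step continuous_on_fst continuous_on_snd) auto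
  then show ?case by (simp add: case_prod_beta)
qed

lemma mean_iter_mono:
  assumes K: "K \<in> H \<times> H \<rightarrow> H" and mono: "monotone2 H K"
    and s: "s \<in> ordered_triples H" and t: "t \<in> ordered_triples H" and "s \<le> t"
  shows "mean_iter K s n \<le> mean_iter K t n"
proof (induction n)
  case 0
  show ?case using \<open>s \<le> t\<close> by simp
next
  case (Suc n)
  obtain a b c where s_it: "mean_iter K s n = (a, b, c)" by (rule prod_cases3)
  obtain a' b' c' where t_it: "mean_iter K t n = (a', b', c')" by (rule prod_cases3)
  show ?case
    using Suc.IH mean_iter_ordered[OF K mono s, of n] mean_iter_ordered[OF K mono t, of n]
    by (auto simp: s_it t_it intro!: monotone2D[OF mono])
qed

theorem theorem5p13:
  fixes H :: "real set"
    and K :: "real \<times> real \<Rightarrow> real"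
    and Kt :: "real \<times> real \<times> real \<Rightarrow> real"
  assumes "K \<in> H \<times> H \<rightarrow> H"
    and "right_mean2 H K"
    and "strict2 H K"
    and "continuous_on (H \<times> H) K"
    and "monotone2 H K"
    and "semi_reflexive H K \<or> bdd_below H"
    and "is_limit_mean H K Kt"
  shows "right_mean3 (ordered_triples H) Kt
    \<and> strict3 (ordered_triples H) Kt
    \<and> usc_on (ordered_triples H) Kt
    \<and> monotone3 (ordered_triples H) Kt"
proof (intro conjI)
  let ?T = "ordered_triples H"
  have limit_le: "Kt t \<le> snd (snd (mean_iter K t n))" if "t \<in> ?T" for t n
    using limit_mean_le_largest[OF assms(1,2,5,7) that] .
  show "right_mean3 ?T Kt"
    unfolding right_mean3_def
  proof clarify
    fix a b c assume abc: "(a, b, c) \<in> ?T"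
    then have "Kt (a, b, c) \<le> c" using limit_le[of "(a, b, c)" 0] by simp
    then show "Kt (a, b, c) \<le> Max {a, b, c}" by simp
  qed
  show "strict3 ?T Kt"
    unfolding strict3_def
  proof clarify
    fix a b c assume abc: "(a, b, c) \<in> ?T" and ne: "\<not> (a = b \<and> b = c)"
    obtain n where "snd (snd (mean_iter K (a, b, c) n)) < c"
      using largest_iterate_strict[OF assms(1-3), of a b c] abc ne by auto
    then have "Kt (a, b, c) < c" using limit_le[OF abc, of n] by simp
    then show "Kt (a, b, c) < Max {a, b, c}" by simp
  qed
  show "usc_on ?T Kt"
    unfolding usc_on_def
  proof (intro ballI allI impI)
    fix t y assume t: "t \<in> ?T" and "Kt t < y"
    let ?c = "\<lambda>n t. snd (snd (mean_iter K t n))"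
    have "(\<lambda>n. ?c n t) \<longlonglongrightarrow> Kt t"
      using assms(7) t unfolding is_limit_mean_def by simp
    then have "\<forall>\<^sub>F n in sequentially. ?c n t < y"
      using \<open>Kt t < y\<close> by (rule order_tendstoD)
    then obtain n where n: "?c n t < y"
      using eventually_happens'[OF sequentially_bot] by blast
    have "continuous_on ?T (?c n)"
      by (intro continuous_on_snd continuous_on_mean_iter[OF assms(1,5,4)])
    then have "(?c n \<longlongrightarrow> ?c n t) (at t within ?T)"
      using t by (simp add: continuous_on_def)
    then have "\<forall>\<^sub>F z in at t within ?T. ?c n z < y"
      using n by (rule order_tendstoD)
    moreover have "\<forall>\<^sub>F z in at t within ?T. z \<in> ?T"
      by (simp add: eventually_at_filter)
    ultimately show "\<forall>\<^sub>F z in at t within ?T. Kt z < y"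
      by eventually_elim (rule le_less_trans[OF limit_le])
  qed
  show "monotone3 ?T Kt"
    unfolding monotone3_def
  proof clarify
    fix a' b' c' a b c
    assume s: "(a', b', c') \<in> ?T" and t: "(a, b, c) \<in> ?T" and le: "a' \<le> a" "b' \<le> b" "c' \<le> c"
    have "fst (mean_iter K (a', b', c') n) \<le> fst (mean_iter K (a, b, c) n)" for n
      using mean_iter_mono[OF assms(1,5) s t, of n] le by (simp add: less_eq_prod_def)
    moreover have "(\<lambda>n. fst (mean_iter K (a', b', c') n)) \<longlonglongrightarrow> Kt (a', b', c')"
      and "(\<lambda>n. fst (mean_iter K (a, b, c) n)) \<longlonglongrightarrow> Kt (a, b, c)"
      using assms(7) s t unfolding is_limit_mean_def by simp_all
    ultimately show "Kt (a', b', c') \<le> Kt (a, b, c)"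
      by (intro LIMSEQ_le) auto
  qed
qed

end
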